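(* Let $\{(b_i,d_i)\}_{i=1}^N$ be a persistence diagram, $K\ge1$ an integer, $M\subset\mathbb{R}$ a finite set, and let $f:\mathbb{R}^{K\times|M|}\to\mathbb{R}$ be a linear model, $f(\lambda)=\sum_{k=1}^K\sum_{m\in M}w_{(k,m)}\lambda(k,m)+b$, with weights $w_{(k,m)}\in\mathbb{R}$ and bias $b\in\mathbb{R}$. Then for every player $i\in\{1,\dots,N\}$, the Shapley value of $i$ in the game $v_f$ is \[\varphi_i(v_f)=\sum_{k=1}^K\sum_{m\in M}w_{(k,m)}\,\varphi_i(v_{(k,m)}).\]
   Context: A persistence diagram here is a finite indexed family of points $(b_i,d_i)\in\mathbb{R}^2$ with $b_i\le d_i$, $i=1,\dots,N$, $N\ge1$. The tent function of point $i$ is $\ell_i(m)=\min(\max(0,m-b_i),\max(0,d_i-m))$. The landscape game $v_{(k,m)}$ on $\{1,\dots,N\}$ is $v_{(k,m)}(S)=$ the $k$-th largest value (with multiplicity) among $\{\ell_i(m):i\in S\}$ if $|S|\ge k$, and $0$ if $|S|<k$. For a coalition $S\subset\{1,\dots,N\}$, $\Lambda(S)\in\mathbb{R}^{K\times|M|}$ is the discretized persistence landscape of the subdiagram of points in $S$, i.e. $\Lambda(S)_{(k,m)}=v_{(k,m)}(S)$ for $k\in\{1,\dots,K\}$, $m\in M$. The game of the model $f$ is $v_f(S)=f(\Lambda(S))$. The Shapley value of player $i$ for a set function $v:2^{\{1,\dots,N\}}\to\mathbb{R}$ is $\varphi_i(v)=\frac1N\sum_{S\subset\{1,\dots,N\}\setminus\{i\}}\binom{N-1}{|S|}^{-1}(v(S\cup\{i\})-v(S))$;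 this formula is used also when $v(\varnothing)\ne0$, as the bias cancels in every marginal contribution. *)

theory Defs
  imports Complex_Main "HOL-Library.FuncSet" "HOL-Library.Multiset"
begin

text \<open>
  The points of a persistence diagram are indexed by \<open>{1..N}\<close>; point \<open>i\<close> is \<open>(b i, d i)\<close>.
\<close>

definition persistence_diagram :: "nat \<Rightarrow> (nat \<Rightarrow> real) \<Rightarrow> (nat \<Rightarrow> real) \<Rightarrow> bool" where
  "persistence_diagram N b d \<longleftrightarrow> N \<ge> 1 \<and> (\<forall>i\<in>{1..N}. b i \<le> d i)"

definition tent :: "(nat \<Rightarrow> real) \<Rightarrow> (nat \<Rightarrow> real) \<Rightarrow> nat \<Rightarrow> real \<Rightarrow> real" where
  "tent b d i m = min (max 0 (m - b i)) (max 0 (d i - m))"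

text \<open>
  The \<open>k\<close>-th largest element counts multiplicities and is meant for \<open>1 \<le> k \<le> size A\<close>
  (positions are counted from 1, list indices from 0).
\<close>

definition kth_largest :: "nat \<Rightarrow> real multiset \<Rightarrow> real" where
  "kth_largest k A = rev (sorted_list_of_multiset A) ! (k - 1)"

definition landscape_game ::
    "(nat \<Rightarrow> real) \<Rightarrow> (nat \<Rightarrow> real) \<Rightarrow> nat \<Rightarrow> real \<Rightarrow> nat set \<Rightarrow> real" where
  "landscape_game b d k m S =
     (if k \<le> card S then kth_largest k {# tent b d i m. i \<in># mset_set S #} else 0)"

text \<open>
  The space of real arrays with index set \<open>{1..K} \<times> M\<close> is rendered as
  \<open>extensional ({1..K} \<times> M)\<close>: functions that are \<open>undefined\<close> off the index set.
\<close>

definition landscape_vec ::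
    "(nat \<Rightarrow> real) \<Rightarrow> (nat \<Rightarrow> real) \<Rightarrow> nat \<Rightarrow> real set \<Rightarrow> nat set \<Rightarrow> (nat \<times> real \<Rightarrow> real)" where
  "landscape_vec b d K M S = (\<lambda>(k, m) \<in> {1..K} \<times> M. landscape_game b d k m S)"

definition model_game ::
    "(nat \<Rightarrow> real) \<Rightarrow> (nat \<Rightarrow> real) \<Rightarrow> nat \<Rightarrow> real set \<Rightarrow> ((nat \<times> real \<Rightarrow> real) \<Rightarrow> real)
      \<Rightarrow> nat set \<Rightarrow> real" where
  "model_game b d K M f S = f (landscape_vec b d K M S)"

text \<open>The formula is used for arbitrary set functions, without requiring \<open>v {} = 0\<close>.\<close>

definition shapley :: "nat \<Rightarrow> (nat set \<Rightarrow> real) \<Rightarrow> nat \<Rightarrow> real" where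
  "shapley N v i =
     1 / real N * (\<Sum>S \<in> Pow ({1..N} - {i}).
       inverse (real ((N - 1) choose card S)) * (v (S \<union> {i}) - v S))"

end

theory Submission
  imports Defs
begin

text \<open>The Shapley value is a fixed weighted sum of the marginal contributions
  \<open>v (S \<union> {i}) - v S\<close>, hence linear in the game, and a constant added to the
  game cancels in each of them. A linear model makes its game a linear combination of landscape
  games plus the bias, so \<open>shapley_sum\<close>, \<open>shapley_cmult\<close> and
  \<open>shapley_add_const\<close> carry the proof.\<close>

lemma shapley_add_const: "shapley N (\<lambda>S. v S + c) i = shapley N v i"
  by (simp add: shapley_def)

lemma shapley_cmult: "shapley N (\<lambda>S. c * v S) i = c * shapley N v i"
proof -
  have "(\<Sum>S\<in>A. g S * (c * v (S \<union> {i}) - c * v S)) = c * (\<Sum>S\<in>A. g S * (v (S \<union> {i}) - v S))"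
    for A and g :: "nat set \<Rightarrow> real"
    by (simp add: sum_distrib_left algebra_simps)
  then show ?thesis
    unfolding shapley_def by (simp only: mult.left_commute)
qed

lemma shapley_sum: "shapley N (\<lambda>S. \<Sum>j\<in>J. v j S) i = (\<Sum>j\<in>J. shapley N (v j) i)"
proof -
  have "(\<Sum>S\<in>A. g S * ((\<Sum>j\<in>J. v j (S \<union> {i})) - (\<Sum>j\<in>J. v j S)))
      = (\<Sum>j\<in>J. \<Sum>S\<in>A. g S * (v j (S \<union> {i}) - v j S))"
    for A and g :: "nat set \<Rightarrow> real"
    \<comment> \<open>The swap acts on the double sum on the right; \<open>g S\<close> then factors
      out of the sum over \<open>J\<close>.\<close>
    by (subst sum.swap) (simp only: sum_subtractf flip: sum_distrib_left)
  then show ?thesis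
    unfolding shapley_def by (simp only: sum_distrib_left)
qed

theorem theorem4p1:
  fixes N K :: nat and b d :: "nat \<Rightarrow> real" and M :: "real set"
    and f :: "(nat \<times> real \<Rightarrow> real) \<Rightarrow> real"
    and w :: "nat \<times> real \<Rightarrow> real" and bias :: real and i :: nat
  assumes "persistence_diagram N b d"
    and "K \<ge> 1"
    and "finite M"
    and "\<And>x. x \<in> extensional ({1..K} \<times> M) \<Longrightarrow>
           f x = (\<Sum>k = 1..K. \<Sum>m\<in>M. w (k, m) * x (k, m)) + bias"
    and "i \<in> {1..N}"
  shows "shapley N (model_game b d K M f) i =
           (\<Sum>k = 1..K. \<Sum>m\<in>M. w (k, m) * shapley N (landscape_game b d k m) i)"
proof -
  have "model_game b d K M f S =
      (\<Sum>k = 1..K. \<Sum>m\<in>M. w (k, m) * landscape_game b d k m S) + bias" for S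
  proof -
    \<comment> \<open>The linear formula for \<open>f\<close> is assumed only on arrays in this
      space.\<close>
    have "landscape_vec b d K M S \<in> extensional ({1..K} \<times> M)"
      by (simp add: landscape_vec_def)
    then show ?thesis
      unfolding model_game_def by (simp add: assms(4) landscape_vec_def)
  qed
  \<comment> \<open>Equality as functions allows rewriting the game inside
    \<open>shapley\<close>.\<close>
  then have "model_game b d K M f =
      (\<lambda>S. (\<Sum>k = 1..K. \<Sum>m\<in>M. w (k, m) * landscape_game b d k m S) + bias)"
    by (rule ext)
  then show ?thesis
    \<comment> \<open>Additivity is used twice, over \<open>k\<close> and over
      \<open>m\<close>.\<close>
    by (simp only: shapley_add_const shapley_sum shapley_cmult)
qed

end
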